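(* Let $q\ge5$ be an integer and, for $n\ge0$, let $\hat a_n,\hat b_n,\hat c_n,\hat d_n,\hat e_n$ be the sums of the values of the vertices of types $A,B,C,D,E$, respectively, on level $n$ of the Pascal pyramid $\mathcal{PP}_{4,q}$. Then $\hat a_1=\hat b_1=\hat c_1=\hat d_1=\hat e_1=0$ and for every $n\ge1$: $$\hat a_{n+1}=2\hat a_n+2\hat b_n+2,\quad \hat b_{n+1}=(q-4)\hat a_n+(q-3)\hat b_n,\quad \hat c_{n+1}=2\hat c_n+4,$$ $$\hat d_{n+1}=\hat a_n+\hat c_n+3\hat d_n+2\hat e_n,\quad \hat e_{n+1}=\hat b_n+(q-4)\hat d_n+(q-2)\hat e_n.$$
   Context: Fix an integer $q\ge5$ and the regular tiling $\{4,q\}$ of the hyperbolic plane by congruent squares, $q$ squares meeting at each vertex; let $d$ be the edge length. Hyperbolic Pascal triangle $\mathcal{HPT}$ (a subgraph of the tiling), built row by row. Row $0$ is a single base vertex $V_0$. The leftmost and rightmost vertices of each row $j\ge1$ are called wingers; every other vertex of row $j\ge 2$ has type $A$ or $B$. From each vertex of row $j$ one draws, in order from left to right, its descending edges (tiling edges going away from $V_0$): $2$ from $V_0$ and from each winger, $q-2$ from each vertex of type $A$, $q-1$ from each vertex of type $B$. For two consecutive vertices of row $j$, the rightmost descending edge of the left one and the leftmost descending edge of the right one end at a common vertex of row $j+1$, which is of type $A$; the two outermost descending edges of row $j$ end at the two wingers of row $j+1$; all remaining descending edges end at distinct vertices of row $j+1$, which are of type $B$. Pascal pyramid $\mathcal{PP}_{4,q}$.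 Place $\mathcal{HPT}$ in the plane $\mathbf{H}^2\times\{0\}$ of $\mathbf{H}^2\times\mathbf{R}$ and copy it to the planes $\mathbf{H}^2\times\{kd\}$, $k=1,2,\dots$, with corresponding vertices on the same fibre (part of the square-prism tiling of $\mathbf{H}^2\times\mathbf{R}$). Vertices are pairs $(v,k)$, $v$ a vertex of $\mathcal{HPT}$, $k\in\mathbb{Z}_{\ge0}$; edges join $(v,k)$–$(w,k)$ for each edge $vw$ of $\mathcal{HPT}$, and $(v,k)$–$(v,k+1)$. Level $n$ is the set of $(v,k)$ with $v$ in row $r$ and $r+k=n$ (edge-distance $n$ from $(V_0,0)$). The value of a vertex is the number of shortest edge paths from $(V_0,0)$ to it. Vertex types on level $n\ge1$: type $1$: $(V_0,k)$, $k\ge1$, and $(w,0)$, $w$ a winger; type $A$ (resp. $B$): $(v,0)$ with $v$ of type $A$ (resp. $B$); type $C$: $(w,k)$, $w$ a winger, $k\ge1$; type $D$ (resp. $E$): $(v,k)$, $k\ge1$, $v$ of type $A$ (resp. $B$). Level $0$ has no vertices of types $A,\dots,E$. *)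

theory Defs
  imports Main
begin

section \<open>The hyperbolic Pascal triangle\<close>

datatype hpt_type = Base | Winger | TypeA | TypeB

fun out_deg :: "nat \<Rightarrow> hpt_type \<Rightarrow> nat" where
  "out_deg q Base = 2"
| "out_deg q Winger = 2"
| "out_deg q TypeA = q - 2"
| "out_deg q TypeB = q - 1"

text \<open>A row is the list of the types of its vertices, from left to right. The ends of the
  descending edges of a row \<open>ts\<close> are numbered from left to right as well. As the rightmost
  edge of a vertex and the leftmost edge of the next vertex share their end, a vertex of
  out-degree \<open>c\<close> moves the position of the end by \<open>c - 1\<close>. So edge number \<open>e\<close> of vertex
  number \<open>i\<close> (both counted from 0) ends at position \<open>first_end q ts i + e\<close>, and the
  rightmost edge of the row ends at position \<open>first_end q ts (length ts)\<close>.\<close>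

definition first_end :: "nat \<Rightarrow> hpt_type list \<Rightarrow> nat \<Rightarrow> nat" where
  "first_end q ts i = (\<Sum>l<i. out_deg q (ts ! l) - 1)"

definition next_row :: "nat \<Rightarrow> hpt_type list \<Rightarrow> hpt_type list" where
  "next_row q ts =
     (let r = first_end q ts (length ts) in
      map (\<lambda>p. if p = 0 \<or> p = r then Winger
               else if p \<in> first_end q ts ` {0<..<length ts} then TypeA
               else TypeB) [0..<Suc r])"

primrec hpt_row :: "nat \<Rightarrow> nat \<Rightarrow> hpt_type list" where
  "hpt_row q 0 = [Base]"
| "hpt_row q (Suc j) = next_row q (hpt_row q j)"

text \<open>The vertex \<open>(j, i)\<close> is number \<open>i\<close>, counted from 0, in row \<open>j\<close>; the base vertex
  is \<open>(0, 0)\<close>.\<close>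

type_synonym hpt_vertex = "nat \<times> nat"

definition hpt_verts :: "nat \<Rightarrow> hpt_vertex set" where
  "hpt_verts q = {(j, i). i < length (hpt_row q j)}"

definition hpt_type_of :: "nat \<Rightarrow> hpt_vertex \<Rightarrow> hpt_type" where
  "hpt_type_of q v = hpt_row q (fst v) ! snd v"

definition hpt_desc :: "nat \<Rightarrow> hpt_vertex \<Rightarrow> hpt_vertex \<Rightarrow> bool" where
  "hpt_desc q v w \<longleftrightarrow>
     v \<in> hpt_verts q \<and> fst w = Suc (fst v) \<and>
     (\<exists>e < out_deg q (hpt_type_of q v). snd w = first_end q (hpt_row q (fst v)) (snd v) + e)"

definition hpt_adj :: "nat \<Rightarrow> hpt_vertex \<Rightarrow> hpt_vertex \<Rightarrow> bool" where
  "hpt_adj q v w \<longleftrightarrow> hpt_desc q v w \<or> hpt_desc q w v"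

lemma hpt_row_1: "hpt_row q 1 = [Winger, Winger]"
  by (simp add: next_row_def first_end_def upt_rec)

lemma hpt_row_2: "hpt_row q 2 = [Winger, TypeA, Winger]"
proof -
  have "hpt_row q 2 = next_row q (hpt_row q 1)"
    by (simp add: numeral_2_eq_2)
  also have "\<dots> = [Winger, TypeA, Winger]"
    unfolding hpt_row_1
    by (auto simp: next_row_def first_end_def upt_rec lessThan_Suc numeral_2_eq_2 image_iff
        intro: bexI[of _ "Suc 0"])
  finally show ?thesis .
qed


section \<open>The Pascal pyramid\<close>

type_synonym pp_vertex = "hpt_vertex \<times> nat"

definition pp_verts :: "nat \<Rightarrow> pp_vertex set" where
  "pp_verts q = hpt_verts q \<times> UNIV"

definition pp_adj :: "nat \<Rightarrow> pp_vertex \<Rightarrow> pp_vertex \<Rightarrow> bool" where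
  "pp_adj q x y \<longleftrightarrow>
     x \<in> pp_verts q \<and> y \<in> pp_verts q \<and>
     (snd x = snd y \<and> hpt_adj q (fst x) (fst y) \<or>
      fst x = fst y \<and> (snd y = Suc (snd x) \<or> snd x = Suc (snd y)))"

definition pp_level :: "nat \<Rightarrow> nat \<Rightarrow> pp_vertex set" where
  "pp_level q n = {x \<in> pp_verts q. fst (fst x) + snd x = n}"

definition edge_path :: "nat \<Rightarrow> pp_vertex \<Rightarrow> pp_vertex \<Rightarrow> pp_vertex list \<Rightarrow> bool" where
  "edge_path q x y xs \<longleftrightarrow>
     xs \<noteq> [] \<and> hd xs = x \<and> last xs = y \<and> successively (pp_adj q) xs"

text \<open>The graph is locally finite, so only finitely many paths have minimal length and the
  cardinality below is a true count.\<close>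

definition pp_value :: "nat \<Rightarrow> pp_vertex \<Rightarrow> nat" where
  "pp_value q x = card {xs. is_arg_min length (edge_path q ((0, 0), 0) x) xs}"

text \<open>Type \<open>P0\<close> is only there to make the type function total: it is the type of the
  vertex on level 0.\<close>

datatype pp_type = P0 | P1 | PA | PB | PC | PD | PE

definition pp_type_of :: "nat \<Rightarrow> pp_vertex \<Rightarrow> pp_type" where
  "pp_type_of q x =
     (case hpt_type_of q (fst x) of
        Base \<Rightarrow> (if snd x = 0 then P0 else P1)
      | Winger \<Rightarrow> (if snd x = 0 then P1 else PC)
      | TypeA \<Rightarrow> (if snd x = 0 then PA else PD)
      | TypeB \<Rightarrow> (if snd x = 0 then PB else PE))"

definition type_sum :: "nat \<Rightarrow> pp_type \<Rightarrow> nat \<Rightarrow> nat" where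
  "type_sum q T n = (\<Sum>x | x \<in> pp_level q n \<and> pp_type_of q x = T. pp_value q x)"

lemma finite_pp_level: "finite (pp_level q n)"
proof (rule finite_subset)
  show "pp_level q n \<subseteq> (SIGMA j:{..n}. {..<length (hpt_row q j)}) \<times> {..n}"
    by (auto simp: pp_level_def pp_verts_def hpt_verts_def)
qed auto

end

theory Submission
  imports Defs
begin

text \<open>Every edge of the pyramid joins consecutive levels and every vertex other than the apex has
  a neighbour one level below, so the shortest paths from the apex are the monotone ones and the
  value of a vertex is the sum of the values of its neighbours below. Summing over a level and
  exchanging the sums, the recurrences only depend on how many neighbours of each type a vertex
  has one level above. Vertices are classified by the type of their base point together with
  whether they lie in the bottom plane, which separates the two kinds of vertices of type \<open>P1\<close>.\<close>

section \<open>Rows of the triangle\<close>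

lemma first_end_0 [simp]: "first_end q ts 0 = 0"
  by (simp add: first_end_def)

lemma first_end_Suc: "first_end q ts (Suc i) = first_end q ts i + (out_deg q (ts ! i) - 1)"
  by (simp add: first_end_def)

lemma out_deg_ge_2: "q \<ge> 4 \<Longrightarrow> out_deg q t \<ge> 2"
  by (cases t) auto

text \<open>Every vertex has at least two descending edges, so each one moves the position forward
  by at least one. Strictness is what separates shared ends from unshared ones.\<close>

lemma strict_mono_first_end:
  assumes "q \<ge> 4"
  shows "strict_mono (first_end q ts)"
  unfolding strict_mono_Suc_iff
proof
  fix i
  show "first_end q ts i < first_end q ts (Suc i)"
    using out_deg_ge_2[OF assms, of "ts ! i"] by (simp add: first_end_Suc)
qed

lemma length_next_row [simp]: "length (next_row q ts) = Suc (first_end q ts (length ts))"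
  by (simp add: next_row_def Let_def)

lemma nth_next_row:
  assumes "p \<le> first_end q ts (length ts)"
  shows "next_row q ts ! p =
    (if p = 0 \<or> p = first_end q ts (length ts) then Winger
     else if p \<in> first_end q ts ` {0<..<length ts} then TypeA else TypeB)"
  using assms by (simp add: next_row_def Let_def nth_map_upt del: upt_Suc)

lemma child_position_le:
  assumes "q \<ge> 4" "i < length ts" "e < out_deg q (ts ! i)"
  shows "first_end q ts i + e \<le> first_end q ts (length ts)"
proof -
  have "first_end q ts i + e \<le> first_end q ts (Suc i)"
    using assms(3) by (simp add: first_end_Suc)
  also have "\<dots> \<le> first_end q ts (length ts)"
    using assms strict_mono_first_end[of q ts] by (simp add: strict_mono_less_eq)
  finally show ?thesis .
qed

text \<open>The first \<open>m\<close> vertices cover an initial segment of positions without gaps: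
  a position is either covered before vertex \<open>m\<close> or within reach of its edges.\<close>

lemma ex_parent_position:
  assumes "p \<le> first_end q ts m" "0 < m" "q \<ge> 4"
  shows "\<exists>i<m. \<exists>e<out_deg q (ts ! i). p = first_end q ts i + e"
  using assms(1,2)
proof (induction m)
  case (Suc m)
  show ?case
  proof (cases "p < first_end q ts m")
    case True
    then have "0 < m" by (cases m) auto
    with True Suc.IH show ?thesis by (metis less_Suc_eq less_imp_le)
  next
    case False
    then have "p - first_end q ts m < out_deg q (ts ! m)"
      using Suc.prems out_deg_ge_2[OF assms(3), of "ts ! m"] by (simp add: first_end_Suc)
    with False show ?thesis by (intro exI[of _ m]) (auto intro!: exI[of _ "p - first_end q ts m"])
  qed
qed simp

text \<open>The first and last edges of vertex \<open>i\<close> end at consecutive values of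
  \<open>first_end\<close>, which are shared with a neighbour or lie at an end of the new row; inner
  edges end strictly between these values.\<close>

lemma nth_next_row_child:
  assumes q: "q \<ge> 4" and i: "i < length ts" and e: "e < out_deg q (ts ! i)"
  shows "next_row q ts ! (first_end q ts i + e) =
    (if e = 0 then if i = 0 then Winger else TypeA
     else if e = out_deg q (ts ! i) - 1 then if Suc i = length ts then Winger else TypeA
     else TypeB)"
proof -
  note sm = strict_mono_first_end[OF q, of ts]
  have d: "out_deg q (ts ! i) \<ge> 2" using out_deg_ge_2[OF q] .
  have eq: "first_end q ts a = first_end q ts b \<longleftrightarrow> a = b" for a b
    using sm by (simp add: strict_mono_eq)
  have zero: "first_end q ts a = 0 \<longleftrightarrow> a = 0" for a
    using eq[of a 0] by simp
  note nth = nth_next_row[OF child_position_le[OF assms]]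
  consider "e = 0" | "e = out_deg q (ts ! i) - 1" "e \<noteq> 0"
    | "0 < e" "e < out_deg q (ts ! i) - 1"
    using e by linarith
  then show ?thesis
  proof cases
    case 1
    with nth i show ?thesis by (auto simp: eq zero)
  next
    case 2
    then have p: "first_end q ts i + e = first_end q ts (Suc i)"
      by (simp add: first_end_Suc)
    have "next_row q ts ! first_end q ts (Suc i) =
      (if Suc i = length ts then Winger else TypeA)"
      using nth i unfolding p by (auto simp: eq zero)
    then show ?thesis using 2 unfolding p by simp
  next
    case 3
    have lt: "first_end q ts i < first_end q ts i + e"
      and gt: "first_end q ts i + e < first_end q ts (Suc i)"
      using 3 by (simp_all add: first_end_Suc)
    \<comment> \<open>No value of a strictly increasing function lies strictly between its values at
      \<open>i\<close> and \<open>Suc i\<close>.\<close>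
    have "first_end q ts i + e \<noteq> first_end q ts l" for l
    proof
      assume "first_end q ts i + e = first_end q ts l"
      with lt gt sm have "i < l" "l < Suc i" by (simp_all add: strict_mono_less)
      then show False by simp
    qed
    with nth lt 3 show ?thesis by (auto simp del: add_is_0)
  qed
qed

lemma length_hpt_row_pos: "0 < length (hpt_row q j)"
  by (cases j) simp_all

lemma length_hpt_row_ge_2:
  assumes "q \<ge> 4"
  shows "length (hpt_row q (Suc j)) \<ge> 2"
  using strict_monoD[OF strict_mono_first_end[OF assms] length_hpt_row_pos, of "hpt_row q j" q j]
  by simp

text \<open>This lets the type of a vertex alone decide whether it is an end of its row, so that the
  types of its children can be counted without knowing its position.\<close>

lemma hpt_row_types:
  assumes "i < length (hpt_row q j)"
  shows "hpt_row q j ! i = Base \<longleftrightarrow> j = 0"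
    and "hpt_row q j ! i = Winger \<longleftrightarrow> 0 < j \<and> (i = 0 \<or> Suc i = length (hpt_row q j))"
proof -
  have "(hpt_row q j ! i = Base \<longleftrightarrow> j = 0) \<and>
    (hpt_row q j ! i = Winger \<longleftrightarrow> 0 < j \<and> (i = 0 \<or> Suc i = length (hpt_row q j)))"
  proof (cases j)
    case (Suc l)
    with assms have "i \<le> first_end q (hpt_row q l) (length (hpt_row q l))" by simp
    with Suc show ?thesis by (simp add: nth_next_row)
  qed (use assms in simp)
  then show "hpt_row q j ! i = Base \<longleftrightarrow> j = 0"
    and "hpt_row q j ! i = Winger \<longleftrightarrow> 0 < j \<and> (i = 0 \<or> Suc i = length (hpt_row q j))"
    by blast+
qed

section \<open>Children in the triangle\<close>

text \<open>Arguments after \<open>q\<close> are parent type, then child type. A child of type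
  \<open>TypeA\<close> has two parents and is counted for each of them.\<close>

fun children_count :: "nat \<Rightarrow> hpt_type \<Rightarrow> hpt_type \<Rightarrow> nat" where
  "children_count q Base Winger = 2"
| "children_count q Winger Winger = 1"
| "children_count q Winger TypeA = 1"
| "children_count q TypeA TypeA = 2"
| "children_count q TypeA TypeB = q - 4"
| "children_count q TypeB TypeA = 2"
| "children_count q TypeB TypeB = q - 3"
| "children_count q _ _ = 0"

lemma hpt_desc_in_verts:
  assumes "q \<ge> 4" "hpt_desc q v w"
  shows "w \<in> hpt_verts q"
  using assms child_position_le[of q "snd v" "hpt_row q (fst v)"]
  by (cases v; cases w) (auto simp: hpt_desc_def hpt_verts_def hpt_type_of_def less_Suc_eq_le)

lemma ex_hpt_parent:
  assumes "q \<ge> 4" "(Suc j, i) \<in> hpt_verts q"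
  shows "\<exists>v. hpt_desc q v (Suc j, i)"
proof -
  have "i \<le> first_end q (hpt_row q j) (length (hpt_row q j))"
    using assms(2) by (simp add: hpt_verts_def)
  from ex_parent_position[OF this length_hpt_row_pos assms(1)]
  obtain l e where "l < length (hpt_row q j)" "e < out_deg q (hpt_row q j ! l)"
    "i = first_end q (hpt_row q j) l + e" by blast
  then have "hpt_desc q (j, l) (Suc j, i)"
    by (auto simp: hpt_desc_def hpt_verts_def hpt_type_of_def)
  then show ?thesis ..
qed

text \<open>Distinct edges of one vertex have distinct ends, so counting children amounts to
  counting edge numbers. The two extreme edges are evaluated by position; the \<open>d - 2\<close>
  inner ones all lead to \<open>TypeB\<close>.\<close>

lemma card_children_of_type:
  assumes q: "q \<ge> 4" and v: "v \<in> hpt_verts q"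
  shows "card {w. hpt_desc q v w \<and> hpt_type_of q w = t} = children_count q (hpt_type_of q v) t"
proof -
  obtain j i where vji: "v = (j, i)" by force
  define ts where "ts = hpt_row q j"
  define d where "d = out_deg q (ts ! i)"
  have i: "i < length ts" using v by (simp add: vji ts_def hpt_verts_def)
  have d2: "d \<ge> 2" unfolding d_def by (rule out_deg_ge_2[OF q])
  define ct where "ct e = (if e = 0 then if i = 0 then Winger else TypeA
     else if e = d - 1 then if Suc i = length ts then Winger else TypeA else TypeB)" for e
  define f where "f e = (Suc j, first_end q ts i + e)" for e
  have desc: "hpt_desc q v w \<longleftrightarrow> (\<exists>e<d. w = f e)" for w
    using v by (cases w) (auto simp: hpt_desc_def hpt_type_of_def vji ts_def d_def f_def)
  have type: "hpt_type_of q (f e) = ct e" if "e < d" for e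
    using nth_next_row_child[OF q i] that
    by (simp add: hpt_type_of_def f_def ts_def[symmetric] d_def ct_def)
  have "{w. hpt_desc q v w \<and> hpt_type_of q w = t} = f ` {e. e < d \<and> ct e = t}"
    unfolding desc using type by auto
  moreover have "inj f" by (auto simp: inj_def f_def)
  ultimately have card: "card {w. hpt_desc q v w \<and> hpt_type_of q w = t} =
      card {e. e < d \<and> ct e = t}"
    by (simp add: card_image inj_on_subset)
  have ti: "hpt_type_of q v = ts ! i" by (simp add: hpt_type_of_def vji ts_def)
  \<comment> \<open>In row 0 the only vertex is both ends of the row, hence two wingers below
    \<open>Base\<close>; in later rows a winger is exactly one end, hence one winger and one
    \<open>TypeA\<close> below it.\<close>
  have len: "length ts = 1" if "j = 0" using that by (simp add: ts_def)
  have len2: "length ts \<ge> 2" if "j > 0"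
    using that length_hpt_row_ge_2[OF q, of "j - 1"] by (simp add: ts_def)
  note types = hpt_row_types[OF i[unfolded ts_def], folded ts_def]
  have ends: "ct 0 = (if i = 0 then Winger else TypeA)"
    "ct (d - 1) = (if Suc i = length ts then Winger else TypeA)"
    using d2 by (auto simp: ct_def)
  \<comment> \<open>As \<open>d \<ge> 2\<close>, the first and the last edge are different.\<close>
  have "{..<d} = insert 0 (insert (d - 1) {1..<d - 1})"
    using d2 by auto
  then have "card {e. e < d \<and> ct e = t} =
      (\<Sum>e\<in>insert 0 (insert (d - 1) {1..<d - 1}). if ct e = t then 1 else 0)"
    by (simp add: sum.If_cases Int_def flip: lessThan_iff)
  also have "\<dots> = (if ct 0 = t then 1 else 0) + (if ct (d - 1) = t then 1 else 0)
      + (\<Sum>e\<in>{1..<d - 1}. if ct e = t then 1 else 0)"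
    using d2 by simp
  also have "(\<Sum>e\<in>{1..<d - 1}. if ct e = t then 1 else 0 :: nat) =
      (\<Sum>e\<in>{1..<d - 1}. if t = TypeB then 1 else 0)"
    by (rule sum.cong) (auto simp: ct_def)
  finally have "card {e. e < d \<and> ct e = t} = (if ct 0 = t then 1 else 0)
      + (if ct (d - 1) = t then 1 else 0) + (if t = TypeB then d - 2 else 0)"
    by (simp add: numeral_2_eq_2)
  also have "\<dots> = children_count q (ts ! i) t"
    unfolding ends using types i len len2 q
    by (cases "ts ! i"; cases t) (auto simp: d_def)
  finally show ?thesis using card ti by simp
qed

section \<open>Shortest paths in the pyramid\<close>

definition level :: "pp_vertex \<Rightarrow> nat" where
  "level x = fst (fst x) + snd x"

lemma pp_level_iff: "x \<in> pp_level q n \<longleftrightarrow> x \<in> pp_verts q \<and> level x = n"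
  by (simp add: pp_level_def level_def)

lemma pp_adj_levels: "pp_adj q x y \<Longrightarrow> level y = Suc (level x) \<or> level x = Suc (level y)"
  by (auto simp: pp_adj_def hpt_adj_def hpt_desc_def level_def)

text \<open>Here \<open>n\<close> counts edges, so the lists have \<open>Suc n\<close> vertices.
  Nothing is assumed about the level of \<open>x\<close> or about the path being monotone.\<close>

definition paths :: "nat \<Rightarrow> nat \<Rightarrow> pp_vertex \<Rightarrow> pp_vertex list set" where
  "paths q n x = {xs. edge_path q ((0, 0), 0) x xs \<and> length xs = Suc n}"

lemma paths_0: "paths q 0 x = (if x = ((0, 0), 0) then {[x]} else {})"
  by (auto simp: paths_def edge_path_def length_Suc_conv)

lemma paths_Suc: "paths q (Suc n) x = (\<Union>y\<in>{y. pp_adj q y x}. (\<lambda>ys. ys @ [x]) ` paths q n y)"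
proof (intro equalityI subsetI)
  fix xs assume "xs \<in> paths q (Suc n) x"
  then have xs: "hd xs = ((0, 0), 0)" "last xs = x" "successively (pp_adj q) xs"
    "length xs = Suc (Suc n)"
    by (auto simp: paths_def edge_path_def)
  then obtain ys where ys: "xs = ys @ [x]"
    by (metis append_butlast_last_id length_0_conv nat.distinct(1))
  with xs have "ys \<noteq> []" by auto
  with ys xs have "ys \<in> paths q n (last ys)" "pp_adj q (last ys) x"
    by (auto simp: paths_def edge_path_def successively_append_iff)
  with ys show "xs \<in> (\<Union>y\<in>{y. pp_adj q y x}. (\<lambda>ys. ys @ [x]) ` paths q n y)" by blast
qed (auto simp: paths_def edge_path_def successively_append_iff)

text \<open>The apex has level 0 and each edge raises the level by at most one.\<close>

lemma level_le_of_path: "xs \<in> paths q n x \<Longrightarrow> level x \<le> n"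
proof (induction n arbitrary: x xs)
  case 0
  then show ?case by (auto simp: paths_0 level_def split: if_splits)
next
  case (Suc n)
  then obtain y ys where "pp_adj q y x" "ys \<in> paths q n y" by (auto simp: paths_Suc)
  with Suc.IH[of ys y] pp_adj_levels[of q y x] show ?case by linarith
qed

text \<open>In the bottom plane a parent in the triangle serves; elsewhere the vertex just below on
  the same fibre does.\<close>

lemma ex_lower_neighbour:
  assumes "q \<ge> 4" "x \<in> pp_level q (Suc n)"
  shows "\<exists>y\<in>pp_level q n. pp_adj q y x"
proof -
  obtain v k where x: "x = (v, k)" by (meson surj_pair)
  show ?thesis
  proof (cases k)
    case 0
    then obtain i where v: "v = (Suc n, i)" "v \<in> hpt_verts q"
      using assms(2) x by (cases v) (auto simp: pp_level_def pp_verts_def)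
    with ex_hpt_parent[OF assms(1)] obtain w where w: "hpt_desc q w v" by blast
    with v 0 x show ?thesis
      by (intro bexI[of _ "(w, 0)"])
        (auto simp: pp_level_def pp_verts_def pp_adj_def hpt_adj_def hpt_desc_def)
  next
    case (Suc l)
    with assms(2) x show ?thesis
      by (intro bexI[of _ "(v, l)"]) (auto simp: pp_level_def pp_verts_def pp_adj_def)
  qed
qed

lemma pp_level_0: "pp_level q 0 = {((0, 0), 0)}"
  by (auto simp: pp_level_def pp_verts_def hpt_verts_def)

lemma paths_nonempty:
  assumes "q \<ge> 4"
  shows "x \<in> pp_level q n \<Longrightarrow> paths q n x \<noteq> {}"
proof (induction n arbitrary: x)
  case 0
  then show ?case by (simp add: pp_level_0 paths_0)
next
  case (Suc n)
  from ex_lower_neighbour[OF assms Suc.prems]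
  obtain y where y: "y \<in> pp_level q n" "pp_adj q y x" by blast
  with Suc.IH[of y] obtain ys where "ys \<in> paths q n y" by blast
  with y have "ys @ [x] \<in> paths q (Suc n) x" unfolding paths_Suc by blast
  then show ?case by blast
qed

text \<open>The level bounds the number of edges from below, and descending step by step to the apex
  shows that the bound is attained.\<close>

lemma pp_value_eq_card_paths:
  assumes "q \<ge> 4" "x \<in> pp_level q n"
  shows "pp_value q x = card (paths q n x)"
proof -
  have lev: "level x = n" using assms(2) by (simp add: pp_level_iff)
  obtain xs0 where xs0: "edge_path q ((0, 0), 0) x xs0" "length xs0 = Suc n"
    using paths_nonempty[OF assms] by (auto simp: paths_def)
  have ge: "Suc n \<le> length xs" if "edge_path q ((0, 0), 0) x xs" for xs
  proof -
    have "xs \<in> paths q (length xs - 1) x" "xs \<noteq> []"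
      using that by (auto simp: paths_def edge_path_def)
    with level_le_of_path[of xs q "length xs - 1" x] lev show ?thesis by (cases xs) simp_all
  qed
  have "{xs. is_arg_min length (edge_path q ((0, 0), 0) x) xs} = paths q n x"
  proof (intro equalityI subsetI)
    fix xs assume "xs \<in> {xs. is_arg_min length (edge_path q ((0, 0), 0) x) xs}"
    then have "edge_path q ((0, 0), 0) x xs" "length xs \<le> Suc n"
      using xs0 by (auto simp: is_arg_min_linorder)
    with ge[of xs] show "xs \<in> paths q n x" by (simp add: paths_def)
  next
    fix xs assume "xs \<in> paths q n x"
    with ge show "xs \<in> {xs. is_arg_min length (edge_path q ((0, 0), 0) x) xs}"
      by (simp add: paths_def is_arg_min_linorder)
  qed
  then show ?thesis by (simp add: pp_value_def)
qed

text \<open>The penultimate vertex is adjacent to level \<open>Suc n\<close>, so its level is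
  \<open>n\<close> or \<open>Suc (Suc n)\<close>; having been reached in \<open>n\<close> edges, it
  lies on level \<open>n\<close>.\<close>

lemma paths_Suc_level:
  assumes "x \<in> pp_level q (Suc n)"
  shows "paths q (Suc n) x =
    (\<Union>y\<in>{y \<in> pp_level q n. pp_adj q y x}. (\<lambda>ys. ys @ [x]) ` paths q n y)"
proof -
  have "y \<in> pp_level q n" if "pp_adj q y x" "ys \<in> paths q n y" for y ys
    using that assms pp_adj_levels[of q y x] level_le_of_path[of ys q n y]
    by (auto simp: pp_level_iff pp_adj_def)
  then show ?thesis unfolding paths_Suc by blast
qed

lemma finite_paths: "x \<in> pp_level q n \<Longrightarrow> finite (paths q n x)"
proof (induction n arbitrary: x)
  case 0
  then show ?case by (simp add: paths_0)
next
  case (Suc n)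
  then show ?case by (auto simp: paths_Suc_level finite_pp_level)
qed

lemma pp_value_Suc:
  assumes q: "q \<ge> 4" and x: "x \<in> pp_level q (Suc n)"
  shows "pp_value q x = (\<Sum>y | y \<in> pp_level q n \<and> pp_adj q y x. pp_value q y)"
proof -
  have "pp_value q x =
      card (\<Union>y\<in>{y \<in> pp_level q n. pp_adj q y x}. (\<lambda>ys. ys @ [x]) ` paths q n y)"
    using pp_value_eq_card_paths[OF q x] paths_Suc_level[OF x] by simp
  also have "\<dots> = (\<Sum>y | y \<in> pp_level q n \<and> pp_adj q y x. card ((\<lambda>ys. ys @ [x]) ` paths q n y))"
    \<comment> \<open>The second \<open>auto\<close> proves disjointness: paths to different
      \<open>y\<close> differ in their last vertex, which remains visible after \<open>x\<close> is
      appended.\<close>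
    by (rule card_UN_disjoint) (auto simp: finite_pp_level finite_paths, auto simp: paths_def edge_path_def)
  also have "\<dots> = (\<Sum>y | y \<in> pp_level q n \<and> pp_adj q y x. pp_value q y)"
    by (rule sum.cong) (auto simp: card_image inj_on_def pp_value_eq_card_paths[OF q])
  finally show ?thesis .
qed

section \<open>Sums over levels\<close>

definition class_of :: "nat \<Rightarrow> pp_vertex \<Rightarrow> hpt_type \<times> bool" where
  "class_of q x = (hpt_type_of q (fst x), snd x = 0)"

definition class_sum :: "nat \<Rightarrow> hpt_type \<times> bool \<Rightarrow> nat \<Rightarrow> nat" where
  "class_sum q c n = (\<Sum>x | x \<in> pp_level q n \<and> class_of q x = c. pp_value q x)"

text \<open>The first summand is the vertical edge, which keeps the base type and always leaves the
  bottom plane. The second counts descending edges of the triangle, which keep the height and hence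
  the flag.\<close>

fun upper_count :: "nat \<Rightarrow> hpt_type \<times> bool \<Rightarrow> hpt_type \<times> bool \<Rightarrow> nat" where
  "upper_count q (s, a) (t, b) =
    (if t = s \<and> \<not> b then 1 else 0) + (if a = b then children_count q s t else 0)"

lemma card_upper_neighbours:
  assumes q: "q \<ge> 4" and y: "y \<in> pp_level q n"
  shows "card {x \<in> pp_level q (Suc n). pp_adj q y x \<and> class_of q x = c} =
    upper_count q (class_of q y) c"
proof -
  obtain v k where yvk: "y = (v, k)" by (meson surj_pair)
  obtain t b where c: "c = (t, b)" by force
  have v: "v \<in> hpt_verts q" using y by (simp add: yvk pp_level_def pp_verts_def)
  \<comment> \<open>\<open>U\<close> is the contribution of the vertical edge and \<open>W\<close>
    that of the horizontal ones; they differ in height.\<close>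
  define U where "U = (if t = hpt_type_of q v \<and> \<not> b then {(v, Suc k)} else {})"
  define W where "W = (if (k = 0) = b then (\<lambda>w. (w, k)) ` {w. hpt_desc q v w \<and> hpt_type_of q w = t}
    else {})"
  have "{x \<in> pp_level q (Suc n). pp_adj q y x \<and> class_of q x = c} = U \<union> W"
    using y v hpt_desc_in_verts[OF q, of v]
    by (auto simp: yvk c U_def W_def pp_level_def pp_verts_def pp_adj_def hpt_adj_def class_of_def
        hpt_desc_def)
  moreover have "finite W"
  proof -
    have "W \<subseteq> pp_level q (Suc n)"
      using y hpt_desc_in_verts[OF q, of v]
      by (auto simp: yvk W_def pp_level_def pp_verts_def hpt_desc_def)
    then show ?thesis using finite_pp_level finite_subset by blast
  qed
  moreover have "U \<inter> W = {}" "finite U" by (auto simp: U_def W_def)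
  ultimately have "card {x \<in> pp_level q (Suc n). pp_adj q y x \<and> class_of q x = c} = card U + card W"
    by (simp add: card_Un_disjoint)
  moreover have "card W = (if (k = 0) = b then children_count q (hpt_type_of q v) t else 0)"
    using card_children_of_type[OF q v, of t] by (simp add: W_def card_image inj_on_def)
  ultimately show ?thesis by (simp add: U_def yvk c class_of_def)
qed

lemma UNIV_hpt_type: "(UNIV :: hpt_type set) = {Base, Winger, TypeA, TypeB}"
  using hpt_type.exhaust by auto

lemma finite_classes: "finite (UNIV :: (hpt_type \<times> bool) set)"
  unfolding UNIV_Times_UNIV[symmetric] by (intro finite_cartesian_product) (simp_all add: UNIV_hpt_type)

text \<open>Double counting of the edges between two levels: the value of \<open>y\<close> is
  counted once per upper neighbour in class \<open>c\<close>, and how many there are depends only on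
  the class of \<open>y\<close>.\<close>

lemma class_sum_Suc:
  assumes q: "q \<ge> 4"
  shows "class_sum q c (Suc n) = (\<Sum>c'\<in>UNIV. upper_count q c' c * class_sum q c' n)"
proof -
  let ?L = "pp_level q n" and ?L' = "{x \<in> pp_level q (Suc n). class_of q x = c}"
  have "class_sum q c (Suc n) = (\<Sum>x\<in>?L'. \<Sum>y | y \<in> ?L \<and> pp_adj q y x. pp_value q y)"
    unfolding class_sum_def by (rule sum.cong) (auto intro: pp_value_Suc[OF q])
  also have "\<dots> = (\<Sum>y\<in>?L. \<Sum>x | x \<in> ?L' \<and> pp_adj q y x. pp_value q y)"
    by (rule sum.swap_restrict) (auto simp: finite_pp_level)
  also have "\<dots> = (\<Sum>y\<in>?L. upper_count q (class_of q y) c * pp_value q y)"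
  proof (rule sum.cong)
    fix y assume "y \<in> ?L"
    then show "(\<Sum>x | x \<in> ?L' \<and> pp_adj q y x. pp_value q y) =
        upper_count q (class_of q y) c * pp_value q y"
      using card_upper_neighbours[OF q, of y n c] by (simp add: conj_ac)
  qed simp
  also have "\<dots> = (\<Sum>c'\<in>UNIV. \<Sum>y | y \<in> ?L \<and> class_of q y = c'.
      upper_count q (class_of q y) c * pp_value q y)"
    by (rule sum.group[symmetric]) (auto simp: finite_pp_level finite_classes)
  also have "\<dots> = (\<Sum>c'\<in>UNIV. upper_count q c' c * class_sum q c' n)"
    unfolding class_sum_def sum_distrib_left by (intro sum.cong) auto
  finally show ?thesis .
qed

text \<open>Spelling out the eight classes lets \<open>simp\<close> evaluate
  \<open>upper_count\<close> in each recurrence.\<close>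

lemma sum_classes:
  fixes f :: "hpt_type \<times> bool \<Rightarrow> nat"
  shows "sum f UNIV = (\<Sum>t\<in>{Base, Winger, TypeA, TypeB}. f (t, True) + f (t, False))"
proof -
  have "sum f UNIV = (\<Sum>t\<in>UNIV. \<Sum>b\<in>UNIV. f (t, b))"
    by (simp add: sum.cartesian_product)
  then show ?thesis by (simp add: UNIV_hpt_type UNIV_bool add.commute)
qed

lemma class_sum_0:
  assumes "q \<ge> 4"
  shows "class_sum q c 0 = (if c = (Base, True) then 1 else 0)"
proof -
  have "{x \<in> pp_level q 0. class_of q x = c} = (if c = (Base, True) then {((0, 0), 0)} else {})"
    by (auto simp: pp_level_0 class_of_def hpt_type_of_def)
  moreover have "pp_value q ((0, 0), 0) = 1"
    using assms pp_value_eq_card_paths[of q _ 0] by (simp add: pp_level_0 paths_0)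
  ultimately show ?thesis by (simp add: class_sum_def)
qed

text \<open>Only the apex has class \<open>(Base, True)\<close>. Its fibre adds one vertex of value
  1 per level and the bottom row two wingers of value 1, which yields the constant terms of the
  recurrences.\<close>

lemma class_sum_boundary:
  assumes q: "q \<ge> 4" and "n \<ge> 1"
  shows "class_sum q (Base, True) n = 0" "class_sum q (Base, False) n = 1"
    "class_sum q (Winger, True) n = 2"
proof -
  have "class_sum q (Base, True) n = 0 \<and> class_sum q (Base, False) n = 1 \<and>
      class_sum q (Winger, True) n = 2"
    using assms(2)
  proof (induction n rule: dec_induct)
    case base
    show ?case by (simp add: class_sum_Suc[OF q] sum_classes class_sum_0[OF q])
  next
    case (step m)
    then show ?case by (simp add: class_sum_Suc[OF q] sum_classes)
  qed
  then show "class_sum q (Base, True) n = 0" "class_sum q (Base, False) n = 1"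
    "class_sum q (Winger, True) n = 2" by blast+
qed

text \<open>Each of these five types is a single class, whereas \<open>P1\<close> combines
  \<open>(Base, False)\<close> and \<open>(Winger, True)\<close>.\<close>

lemma type_sum_eq_class_sum:
  "type_sum q PA n = class_sum q (TypeA, True) n"
  "type_sum q PB n = class_sum q (TypeB, True) n"
  "type_sum q PC n = class_sum q (Winger, False) n"
  "type_sum q PD n = class_sum q (TypeA, False) n"
  "type_sum q PE n = class_sum q (TypeB, False) n"
proof -
  have "pp_type_of q x = PA \<longleftrightarrow> class_of q x = (TypeA, True)"
    "pp_type_of q x = PB \<longleftrightarrow> class_of q x = (TypeB, True)"
    "pp_type_of q x = PC \<longleftrightarrow> class_of q x = (Winger, False)"
    "pp_type_of q x = PD \<longleftrightarrow> class_of q x = (TypeA, False)"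
    "pp_type_of q x = PE \<longleftrightarrow> class_of q x = (TypeB, False)" for x
    by (simp_all add: pp_type_of_def class_of_def split: hpt_type.splits)
  then show "type_sum q PA n = class_sum q (TypeA, True) n"
    "type_sum q PB n = class_sum q (TypeB, True) n"
    "type_sum q PC n = class_sum q (Winger, False) n"
    "type_sum q PD n = class_sum q (TypeA, False) n"
    "type_sum q PE n = class_sum q (TypeB, False) n"
    by (simp_all add: type_sum_def class_sum_def)
qed

theorem theorem3:
  fixes q :: nat
  assumes "q \<ge> 5"
  shows "type_sum q PA 1 = 0 \<and> type_sum q PB 1 = 0 \<and> type_sum q PC 1 = 0 \<and>
         type_sum q PD 1 = 0 \<and> type_sum q PE 1 = 0 \<and>
         (\<forall>n\<ge>1.
           type_sum q PA (n + 1) = 2 * type_sum q PA n + 2 * type_sum q PB n + 2 \<and>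
           type_sum q PB (n + 1) = (q - 4) * type_sum q PA n + (q - 3) * type_sum q PB n \<and>
           type_sum q PC (n + 1) = 2 * type_sum q PC n + 4 \<and>
           type_sum q PD (n + 1) =
             type_sum q PA n + type_sum q PC n + 3 * type_sum q PD n + 2 * type_sum q PE n \<and>
           type_sum q PE (n + 1) =
             type_sum q PB n + (q - 4) * type_sum q PD n + (q - 2) * type_sum q PE n)"
proof -
  have q: "q \<ge> 4" using assms by simp
  note step = type_sum_eq_class_sum class_sum_Suc[OF q] sum_classes
  \<comment> \<open>The coefficient of \<open>PE\<close> in its own recurrence arises as
    \<open>q - 3\<close> horizontal edges plus the vertical one.\<close>
  have q3: "q - 2 = Suc (q - 3)" using assms by simp
  \<comment> \<open>All upper neighbours of the apex have class \<open>(Base, False)\<close> or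
    \<open>(Winger, True)\<close>.\<close>
  have "type_sum q T 1 = 0" if "T \<in> {PA, PB, PC, PD, PE}" for T
    using that by (auto simp: step class_sum_0[OF q])
  moreover have "type_sum q PA (n + 1) = 2 * type_sum q PA n + 2 * type_sum q PB n + 2 \<and>
      type_sum q PB (n + 1) = (q - 4) * type_sum q PA n + (q - 3) * type_sum q PB n \<and>
      type_sum q PC (n + 1) = 2 * type_sum q PC n + 4 \<and>
      type_sum q PD (n + 1) =
        type_sum q PA n + type_sum q PC n + 3 * type_sum q PD n + 2 * type_sum q PE n \<and>
      type_sum q PE (n + 1) =
        type_sum q PB n + (q - 4) * type_sum q PD n + (q - 2) * type_sum q PE n" if "n \<ge> 1" for n
    \<comment> \<open>The 2 for \<open>PA\<close> comes from the bottom wingers. The 4 for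
      \<open>PC\<close> is 2 from the fibre over the base vertex, which has two winger children,
      plus 2 from the vertical edges at the bottom wingers.\<close>
    using class_sum_boundary[OF q that] by (simp add: step q3)
  ultimately show ?thesis by simp
qed

end
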